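(* Let $\Delta t>0$, $\varepsilon>0$, and let $\phi^{n}\in\mathcal{C}_{\rm per}$ satisfy $\delta_0\le\phi^n$ point-wise for some $\delta_0>0$. Then there exists a unique solution $\phi^{n+1}\in\mathcal{C}_{\rm per}$ (with associated $\mu^{n+1}\in\mathcal{C}_{\rm per}$) of the scheme $$\frac{\phi^{n+1}-\phi^{n}}{\Delta t}=\Delta_h \mu^{n+1},\qquad \mu^{n+1}=-\frac{8}{3}(\phi^{n+1})^{-9}+\frac{8}{3}(\phi^{n})^{-3}-\varepsilon^2\Delta_h\phi^{n+1},$$ with $\overline{\phi^{n+1}}=\overline{\phi^n}$ and $\phi^{n+1}>0$ point-wise.
   Context: Let $\Omega=(0,L)^3$, $L>0$, $N\in\mathbb{N}$, $h=L/N$. $\mathcal{C}_{\rm per}$ is the space of real grid functions $\upsilon=(\upsilon_{i,j,k})_{i,j,k\in\mathbb{Z}}$ that are $N$-periodic in each index, where $\upsilon_{i,j,k}=\upsilon(p_i,p_j,p_k)$, $p_i=(i-\tfrac12)h$. The mean is $\overline{\upsilon}=\frac{h^3}{|\Omega|}\sum_{i,j,k=1}^N\upsilon_{i,j,k}$. The discrete Laplacian is $$\Delta_h\upsilon_{i,j,k}=\frac1{h^2}(\upsilon_{i+1,j,k}+\upsilon_{i-1,j,k}+\upsilon_{i,j+1,k}+\upsilon_{i,j-1,k}+\upsilon_{i,j,k+1}+\upsilon_{i,j,k-1}-6\upsilon_{i,j,k}).$$ Powers of grid functions are taken point-wise. *)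

theory Defs
  imports "HOL-Analysis.Analysis"
begin

(* A grid function is represented by its values at the cell centres:
   v i j k stands for the value at the point (p_i, p_j, p_k) with p_i = (i - 1/2) h. *)
type_synonym grid_fun = "int \<Rightarrow> int \<Rightarrow> int \<Rightarrow> real"

definition mesh :: "real \<Rightarrow> nat \<Rightarrow> real" where
  "mesh L N = L / real N"

definition C_per :: "nat \<Rightarrow> grid_fun set" where
  "C_per N = {v. \<forall>i j k. v (i + int N) j k = v i j k
                       \<and> v i (j + int N) k = v i j k
                       \<and> v i j (k + int N) = v i j k}"

(* L ^ 3 is the volume of the cube (0, L)^3. *)
definition grid_mean :: "real \<Rightarrow> nat \<Rightarrow> grid_fun \<Rightarrow> real" where
  "grid_mean L N v =
     mesh L N ^ 3 / L ^ 3 * (\<Sum>i\<in>{1..int N}. \<Sum>j\<in>{1..int N}. \<Sum>k\<in>{1..int N}. v i j k)"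

definition discrete_laplacian :: "real \<Rightarrow> grid_fun \<Rightarrow> grid_fun" where
  "discrete_laplacian h v = (\<lambda>i j k. 1 / h\<^sup>2 *
     (v (i + 1) j k + v (i - 1) j k + v i (j + 1) k + v i (j - 1) k
      + v i j (k + 1) + v i j (k - 1) - 6 * v i j k))"

end

theory Submission
  imports Defs
begin

text \<open>
  Solutions come from a minimisation problem. Formally, the scheme is the Euler--Lagrange equation
  of \<open>\<phi> \<mapsto> \<parallel>\<phi> - \<phi>\<^sub>n\<parallel>\<^sup>2 / (2\<Delta>t)\<close> (in the discrete $H^{-1}$ norm) plus the sum over one period of
  \<open>\<phi>\<^sup>-\<^sup>8 / 3 + g \<phi>\<close> plus \<open>\<epsilon>\<^sup>2/2\<close> times the Dirichlet form of \<open>\<phi>\<close>, where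
  \<open>g = 8/3 \<phi>\<^sub>n\<^sup>-\<^sup>3\<close> and the mean of \<open>\<phi>\<close> is prescribed.
  Writing \<open>\<phi> = \<phi>\<^sub>n + \<Delta>t \<Delta>\<^sub>h \<psi>\<close> and minimising over \<open>\<psi>\<close> removes both the mean constraint and the
  inverse Laplacian: the $H^{-1}$ term becomes \<open>\<Delta>t/2\<close> times the Dirichlet form of \<open>\<psi>\<close>.

  A minimiser exists because all three terms are nonnegative on positive states. Hence a bound on
  the energy keeps \<open>\<phi>\<close> away from \<open>0\<close> (through \<open>\<phi>\<^sup>-\<^sup>8\<close>), and it bounds the oscillation of \<open>\<psi>\<close>
  (through the Dirichlet form, as the periodic grid is connected). As only \<open>\<psi>\<close> up to constants
  matters, one may look for the minimiser in a compact set of grid functions; this is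
  \<open>energy_minimiser_exists\<close>. The barrier keeps the minimiser in the open set of positive states,
  so its directional derivatives vanish. They are the inner products of the direction with
  \<open>\<Delta>t \<Delta>\<^sub>h(\<mu> - \<psi>)\<close>. Testing with \<open>\<Delta>\<^sub>h(\<mu> - \<psi>)\<close> itself gives
  \<open>\<Delta>\<^sub>h \<mu> = \<Delta>\<^sub>h \<psi> = (\<phi> - \<phi>\<^sub>n)/\<Delta>t\<close>, which is \<open>scheme_solution_exists\<close>.

  Uniqueness is monotonicity. If \<open>d\<close> and \<open>m\<close> are the differences of two solutions and of their
  potentials, the sum of \<open>m d\<close> is nonpositive by the evolution equation, \<open>d = \<Delta>t \<Delta>\<^sub>h m\<close>, and
  nonnegative by the definition of the potential, as \<open>-\<phi>\<^sup>-\<^sup>9\<close> is increasing and \<open>-\<Delta>\<^sub>h\<close> is positive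
  semidefinite. Strict monotonicity then forces \<open>d = 0\<close>.
\<close>

section \<open>Periodic grid functions\<close>

definition grid_sum :: "nat \<Rightarrow> grid_fun \<Rightarrow> real" where
  "grid_sum N w = (\<Sum>i\<in>{1..int N}. \<Sum>j\<in>{1..int N}. \<Sum>k\<in>{1..int N}. w i j k)"

lemma C_perI:
  assumes "\<And>i j k. v (i + int N) j k = v i j k"
    and "\<And>i j k. v i (j + int N) k = v i j k"
    and "\<And>i j k. v i j (k + int N) = v i j k"
  shows "v \<in> C_per N"
  using assms by (simp add: C_per_def)

lemma C_perD:
  assumes "v \<in> C_per N"
  shows "v (i + int N) j k = v i j k" "v i (j + int N) k = v i j k" "v i j (k + int N) = v i j k"
  using assms by (simp_all add: C_per_def)

lemma C_per_shift:
  assumes "v \<in> C_per N"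
  shows "(\<lambda>i j k. v (i + a) (j + b) (k + c)) \<in> C_per N"
proof -
  have "x + int N + y = x + y + int N" for x y :: int
    by simp
  then show ?thesis
    by (intro C_perI) (simp_all only: C_perD[OF assms])
qed

text \<open>
  Periodicity passes to pointwise combinations; unary operations are obtained from an \<open>f\<close> that
  ignores one argument.
\<close>
lemma C_per_map2:
  assumes "u \<in> C_per N" "v \<in> C_per N"
  shows "(\<lambda>i j k. f (u i j k) (v i j k)) \<in> C_per N"
  by (intro C_perI) (simp_all add: C_perD[OF assms(1)] C_perD[OF assms(2)])

lemma C_per_laplacian:
  assumes "v \<in> C_per N"
  shows "discrete_laplacian h v \<in> C_per N"
proof -
  have "x + int N + 1 = x + 1 + int N" "x + int N - 1 = x - 1 + int N" for x :: int
    by simp_all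
  then show ?thesis
    unfolding discrete_laplacian_def
    by (intro C_perI) (simp_all only: C_perD[OF assms])
qed

lemma periodic_int_mult:
  fixes f :: "int \<Rightarrow> 'a"
  assumes "\<And>i. f (i + int N) = f i"
  shows "f (i + z * int N) = f i"
proof -
  have *: "f (i + int n * int N) = f i" for n i
  proof (induction n)
    case (Suc n)
    have "i + int (Suc n) * int N = (i + int n * int N) + int N"
      by (simp add: algebra_simps)
    then show ?case using Suc assms by metis
  qed simp
  show ?thesis
  proof (cases "z \<ge> 0")
    case True
    then show ?thesis using *[of i "nat z"] by simp
  next
    case False
    then show ?thesis using *[of "i + z * int N" "nat (- z)"] by simp
  qed
qed

text \<open>
  Every index has a representative in a prescribed window of length \<open>N\<close>. With \<open>a = 1\<close> this
  transfers facts from one period to the whole grid; with arbitrary \<open>a\<close> it says that any index is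
  fewer than \<open>N\<close> steps away from \<open>a\<close>.
\<close>
lemma periodic_on_window:
  fixes f :: "int \<Rightarrow> 'a"
  assumes "N \<ge> 1" and "\<And>i. f (i + int N) = f i"
  shows "f i = f ((i - a) mod int N + a)"
proof -
  have "i = ((i - a) mod int N + a) + ((i - a) div int N) * int N"
    by (simp add: algebra_simps)
  then show ?thesis
    using periodic_int_mult[of f N, OF assms(2)] by metis
qed

lemma C_per_all_if_on_grid:
  assumes "N \<ge> 1" "v \<in> C_per N"
    and "\<And>i j k. i \<in> {1..int N} \<Longrightarrow> j \<in> {1..int N} \<Longrightarrow> k \<in> {1..int N} \<Longrightarrow> P (v i j k)"
  shows "P (v i j k)"
proof -
  define r where "r = (\<lambda>x. (x - 1) mod int N + 1)"
  have r: "r x \<in> {1..int N}" for x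
  proof -
    have "0 \<le> (x - 1) mod int N" "(x - 1) mod int N < int N"
      using assms(1) by simp_all
    then show ?thesis
      unfolding r_def atLeastAtMost_iff by linarith
  qed
  have "v i j k = v (r i) j k"
    unfolding r_def
    using periodic_on_window[of N "\<lambda>x. v x j k" i 1, OF assms(1)] C_perD(1)[OF assms(2)] by simp
  also have "\<dots> = v (r i) (r j) k"
    using periodic_on_window[of N "\<lambda>x. v (r i) x k" j 1, OF assms(1)] C_perD(2)[OF assms(2)]
    by (simp add: r_def)
  also have "\<dots> = v (r i) (r j) (r k)"
    using periodic_on_window[of N "\<lambda>x. v (r i) (r j) x" k 1, OF assms(1)] C_perD(3)[OF assms(2)]
    by (simp add: r_def)
  finally show ?thesis
    using assms(3)[OF r r r] by simp
qed

lemma sum_shift_periodic: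
  fixes f :: "int \<Rightarrow> real"
  assumes "\<And>i. f (i + int N) = f i"
  shows "(\<Sum>i\<in>{1..int N}. f (i + 1)) = (\<Sum>i\<in>{1..int N}. f i)"
proof (cases "N = 0")
  case False
  have "(\<Sum>i\<in>{1..int N}. f (i + 1)) = (\<Sum>i\<in>{2..int N + 1}. f i)"
    by (rule sum.reindex_bij_witness[of _ "\<lambda>i. i - 1" "\<lambda>i. i + 1"]) auto
  also have "{2..int N + 1} = insert (int N + 1) {2..int N}"
    using False by auto
  also have "(\<Sum>i\<in>\<dots>. f i) = f (int N + 1) + (\<Sum>i\<in>{2..int N}. f i)"
    by simp
  also have "f (int N + 1) = f 1"
    using assms[of 1] by (simp add: add.commute)
  also have "f 1 + (\<Sum>i\<in>{2..int N}. f i) = (\<Sum>i\<in>insert 1 {2..int N}. f i)"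
    by simp
  also have "insert 1 {2..int N} = {1..int N}"
    using False by auto
  finally show ?thesis .
qed simp

lemma grid_sum_shift:
  assumes "w \<in> C_per N"
  shows "grid_sum N (\<lambda>i j k. w (i + 1) j k) = grid_sum N w"
    and "grid_sum N (\<lambda>i j k. w i (j + 1) k) = grid_sum N w"
    and "grid_sum N (\<lambda>i j k. w i j (k + 1)) = grid_sum N w"
  unfolding grid_sum_def
  using sum_shift_periodic[of "\<lambda>i. \<Sum>j\<in>{1..int N}. \<Sum>k\<in>{1..int N}. w i j k" N]
    sum_shift_periodic[of "\<lambda>j. \<Sum>k\<in>{1..int N}. w _ j k" N]
    sum_shift_periodic[of "\<lambda>k. w _ _ k" N]
  by (simp_all add: C_perD[OF assms])

lemma grid_sum_add: "grid_sum N (\<lambda>i j k. u i j k + v i j k) = grid_sum N u + grid_sum N v"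
  by (simp add: grid_sum_def sum.distrib)

lemma grid_sum_diff: "grid_sum N (\<lambda>i j k. u i j k - v i j k) = grid_sum N u - grid_sum N v"
  by (simp add: grid_sum_def sum_subtractf)

lemma grid_sum_cmult: "grid_sum N (\<lambda>i j k. c * u i j k) = c * grid_sum N u"
  by (simp add: grid_sum_def sum_distrib_left)

lemma grid_sum_nonneg:
  assumes "\<And>i j k. 0 \<le> w i j k"
  shows "0 \<le> grid_sum N w"
  unfolding grid_sum_def using assms by (intro sum_nonneg) auto

lemma grid_sum_triples:
  "grid_sum N w = (\<Sum>(i, j, k)\<in>{1..int N} \<times> {1..int N} \<times> {1..int N}. w i j k)"
  by (simp add: grid_sum_def sum.cartesian_product case_prod_beta)

text \<open>
  The way in which bounds on sums over a period become pointwise bounds: a single nonnegative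
  summand is at most the sum, and by periodicity every grid value occurs as a summand.
\<close>
lemma le_grid_sum:
  assumes "N \<ge> 1" "w \<in> C_per N" "\<And>i j k. 0 \<le> w i j k"
  shows "w i j k \<le> grid_sum N w"
proof (rule C_per_all_if_on_grid[OF assms(1,2)])
  fix i j k assume "i \<in> {1..int N}" "j \<in> {1..int N}" "k \<in> {1..int N}"
  then show "w i j k \<le> grid_sum N w"
    using member_le_sum[of "(i, j, k)" "{1..int N} \<times> {1..int N} \<times> {1..int N}"
        "\<lambda>(i, j, k). w i j k"] assms(3)
    by (simp add: grid_sum_triples case_prod_beta)
qed

lemma DERIV_grid_sum:
  assumes "\<And>i j k. ((\<lambda>t. f t i j k) has_real_derivative f' i j k) F"
  shows "((\<lambda>t. grid_sum N (f t)) has_real_derivative grid_sum N f') F"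
  unfolding grid_sum_def using assms by (intro DERIV_sum)

section \<open>The discrete Laplacian and its Dirichlet form\<close>

text \<open>
  The discrete analogue of \<open>\<integral> \<nabla>u \<cdot> \<nabla>v\<close>, without the volume factor \<open>h\<^sup>3\<close>. Forward differences
  suffice, since over a period each edge of the grid is met exactly once.
\<close>
definition dirichlet :: "nat \<Rightarrow> real \<Rightarrow> grid_fun \<Rightarrow> grid_fun \<Rightarrow> real" where
  "dirichlet N h u v = 1 / h\<^sup>2 * grid_sum N (\<lambda>i j k.
      (u (i + 1) j k - u i j k) * (v (i + 1) j k - v i j k)
    + (u i (j + 1) k - u i j k) * (v i (j + 1) k - v i j k)
    + (u i j (k + 1) - u i j k) * (v i j (k + 1) - v i j k))"

lemma dirichlet_commute: "dirichlet N h u v = dirichlet N h v u"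
  by (simp add: dirichlet_def mult.commute)

lemma dirichlet_nonneg: "0 \<le> dirichlet N h u u"
  unfolding dirichlet_def
  by (intro mult_nonneg_nonneg[OF _ grid_sum_nonneg] add_nonneg_nonneg zero_le_square) simp

text \<open>
  In each direction, \<open>u \<Delta>v\<close> and the negated product of forward differences differ by the increments
  of \<open>u v\<close> and of \<open>u\<close> times the backward shift of \<open>v\<close>. Increments of periodic functions sum to
  zero over a period, so there is no boundary term. Symmetry, negative semidefiniteness and
  conservation of mean all follow.
\<close>
lemma sum_by_parts:
  assumes u: "u \<in> C_per N" and v: "v \<in> C_per N"
  shows "grid_sum N (\<lambda>i j k. u i j k * discrete_laplacian h v i j k) = - dirichlet N h u v"
proof -
  define p where "p = (\<lambda>i j k. u i j k * v i j k)"
  define q1 where "q1 = (\<lambda>i j k. u i j k * v (i - 1) j k)"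
  define q2 where "q2 = (\<lambda>i j k. u i j k * v i (j - 1) k)"
  define q3 where "q3 = (\<lambda>i j k. u i j k * v i j (k - 1))"
  have p: "p \<in> C_per N"
    unfolding p_def by (rule C_per_map2[OF u v])
  have q1: "q1 \<in> C_per N"
    unfolding q1_def using C_per_map2[OF u C_per_shift[OF v, of "-1" 0 0], of "(*)"] by simp
  have q2: "q2 \<in> C_per N"
    unfolding q2_def using C_per_map2[OF u C_per_shift[OF v, of 0 "-1" 0], of "(*)"] by simp
  have q3: "q3 \<in> C_per N"
    unfolding q3_def using C_per_map2[OF u C_per_shift[OF v, of 0 0 "-1"], of "(*)"] by simp
  let ?D = "\<lambda>i j k. (u (i + 1) j k - u i j k) * (v (i + 1) j k - v i j k)
    + (u i (j + 1) k - u i j k) * (v i (j + 1) k - v i j k)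
    + (u i j (k + 1) - u i j k) * (v i j (k + 1) - v i j k)"
  define c where "c = 1 / h\<^sup>2"
  have "u i j k * discrete_laplacian h v i j k =
      c * ((p (i + 1) j k - p i j k) - (q1 (i + 1) j k - q1 i j k)
        + (p i (j + 1) k - p i j k) - (q2 i (j + 1) k - q2 i j k)
        + (p i j (k + 1) - p i j k) - (q3 i j (k + 1) - q3 i j k) - ?D i j k)" for i j k
    unfolding c_def discrete_laplacian_def p_def q1_def q2_def q3_def by (simp add: algebra_simps)
  then show ?thesis
    by (simp only: grid_sum_cmult grid_sum_add grid_sum_diff grid_sum_shift[OF p]
        grid_sum_shift[OF q1] grid_sum_shift[OF q2] grid_sum_shift[OF q3] dirichlet_def flip: c_def)
       (simp add: algebra_simps)
qed

lemma grid_sum_laplacian: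
  assumes "v \<in> C_per N"
  shows "grid_sum N (discrete_laplacian h v) = 0"
  using sum_by_parts[of "\<lambda>_ _ _. 1" N v h] assms
  by (simp add: dirichlet_def C_per_def grid_sum_def)

lemma laplacian_self_adjoint:
  assumes "u \<in> C_per N" "v \<in> C_per N"
  shows "grid_sum N (\<lambda>i j k. u i j k * discrete_laplacian h v i j k)
       = grid_sum N (\<lambda>i j k. discrete_laplacian h u i j k * v i j k)"
  using sum_by_parts[OF assms] sum_by_parts[OF assms(2,1)] dirichlet_commute[of N h u v]
  by (simp add: mult.commute)

lemma laplacian_lincomb:
  "discrete_laplacian h (\<lambda>i j k. u i j k + t * v i j k) i j k
    = discrete_laplacian h u i j k + t * discrete_laplacian h v i j k"
  by (simp add: discrete_laplacian_def algebra_simps)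

lemma laplacian_diff:
  "discrete_laplacian h (\<lambda>i j k. u i j k - v i j k) i j k
    = discrete_laplacian h u i j k - discrete_laplacian h v i j k"
  by (simp add: discrete_laplacian_def algebra_simps)

text \<open>
  The Laplacian and the Dirichlet form see \<open>u\<close> only up to constants; this allows a minimising
  \<open>\<psi>\<close> to be normalised to vanish at one point.
\<close>
lemma laplacian_minus_const:
  "discrete_laplacian h (\<lambda>i j k. u i j k - c) = discrete_laplacian h u"
  by (simp add: discrete_laplacian_def fun_eq_iff)

lemma dirichlet_minus_const:
  "dirichlet N h (\<lambda>i j k. u i j k - c) (\<lambda>i j k. u i j k - c) = dirichlet N h u u"
  by (simp add: dirichlet_def)

lemma DERIV_dirichlet_line:
  "((\<lambda>t. dirichlet N h (\<lambda>i j k. u i j k + t * v i j k) (\<lambda>i j k. u i j k + t * v i j k))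
     has_real_derivative 2 * dirichlet N h u v) (at 0)"
  unfolding dirichlet_def
  by (rule DERIV_cong, (rule DERIV_cmult DERIV_grid_sum)+, (rule derivative_eq_intros refl)+)
     (simp_all flip: grid_sum_cmult add: algebra_simps)

text \<open>
  Walking from \<open>a\<close> upwards, one meets an index congruent to \<open>i\<close> within \<open>N\<close> steps.
\<close>
lemma periodic_lipschitz_bound:
  fixes f :: "int \<Rightarrow> real"
  assumes "N \<ge> 1" "\<And>i. f (i + int N) = f i" "\<And>i. \<bar>f (i + 1) - f i\<bar> \<le> c"
  shows "\<bar>f i - f a\<bar> \<le> real N * c"
proof -
  have *: "\<bar>f (int n + a) - f a\<bar> \<le> real n * c" for n
  proof (induction n)
    case (Suc n)
    then show ?case using assms(3)[of "int n + a"] by (simp add: algebra_simps)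
  qed simp
  have c: "0 \<le> c" using assms(3)[of 0] by linarith
  have "\<bar>f i - f a\<bar> \<le> real (nat ((i - a) mod int N)) * c"
    using *[of "nat ((i - a) mod int N)"] periodic_on_window[of N f i a] assms(1,2) by simp
  also have "\<dots> \<le> real N * c"
    using c assms(1) pos_mod_bound[of "int N" "i - a"] by (intro mult_right_mono) linarith+
  finally show ?thesis .
qed

text \<open>
  A crude discrete Poincare inequality. The Dirichlet form bounds every single edge difference, and
  any two points are joined, up to periodicity, by a path with at most \<open>N\<close> edges in each of the
  three directions.
\<close>
lemma dirichlet_controls_oscillation:
  assumes "N \<ge> 1" "h \<noteq> 0" and v: "v \<in> C_per N"
  shows "\<bar>v i j k - v 1 1 1\<bar> \<le> 3 * real N * sqrt (h\<^sup>2 * dirichlet N h v v)"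
proof -
  define w where "w = (\<lambda>i j k.
      (v (i + 1) j k - v i j k) * (v (i + 1) j k - v i j k)
    + (v i (j + 1) k - v i j k) * (v i (j + 1) k - v i j k)
    + (v i j (k + 1) - v i j k) * (v i j (k + 1) - v i j k))"
  define c where "c = sqrt (h\<^sup>2 * dirichlet N h v v)"
  have s: "x + int N + 1 = x + 1 + int N" for x :: int
    by simp
  have wper: "w \<in> C_per N"
    unfolding w_def by (intro C_perI) (simp_all only: s C_perD[OF v])
  have "w i j k \<le> h\<^sup>2 * dirichlet N h v v" for i j k
    using le_grid_sum[OF assms(1) wper] assms(2) by (simp add: dirichlet_def w_def)
  then have w: "sqrt (w i j k) \<le> c" for i j k
    unfolding c_def by simp
  have "\<bar>v (i + 1) j k - v i j k\<bar> \<le> sqrt (w i j k)"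
       "\<bar>v i (j + 1) k - v i j k\<bar> \<le> sqrt (w i j k)"
       "\<bar>v i j (k + 1) - v i j k\<bar> \<le> sqrt (w i j k)" for i j k
    unfolding w_def by (rule real_le_rsqrt, simp add: power2_eq_square)+
  then have e: "\<bar>v (i + 1) j k - v i j k\<bar> \<le> c" "\<bar>v i (j + 1) k - v i j k\<bar> \<le> c"
       "\<bar>v i j (k + 1) - v i j k\<bar> \<le> c" for i j k
    using w order_trans by blast+
  have "\<bar>v i j k - v 1 j k\<bar> \<le> real N * c"
    using periodic_lipschitz_bound[of N "\<lambda>x. v x j k" c i 1] assms(1) C_perD[OF v] e by simp
  moreover have "\<bar>v 1 j k - v 1 1 k\<bar> \<le> real N * c"
    using periodic_lipschitz_bound[of N "\<lambda>x. v 1 x k" c j 1] assms(1) C_perD[OF v] e by simp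
  moreover have "\<bar>v 1 1 k - v 1 1 1\<bar> \<le> real N * c"
    using periodic_lipschitz_bound[of N "\<lambda>x. v 1 1 x" c k 1] assms(1) C_perD[OF v] e by simp
  ultimately show ?thesis
    unfolding c_def[symmetric] by linarith
qed

section \<open>The space of grid functions with the product topology\<close>

text \<open>
  Tychonoff's theorem. Iterating it over the three indices makes uniformly bounded grid functions a
  compact set for pointwise convergence, and periodicity is a closed condition. Hence
  minimisers can be sought among the periodic functions themselves.
\<close>
lemma compact_functions_into:
  assumes "compact S"
  shows "compact {f :: 'a \<Rightarrow> 'b::topological_space. \<forall>x. f x \<in> S}"
proof -
  have "compactin (product_topology (\<lambda>_. euclidean) UNIV) (PiE (UNIV :: 'a set) (\<lambda>_. S))"
    using assms by (simp add: compactin_PiE)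
  moreover have "PiE UNIV (\<lambda>_. S) = {f :: 'a \<Rightarrow> 'b. \<forall>x. f x \<in> S}"
    by (auto simp: PiE_def Pi_def extensional_def)
  ultimately show ?thesis
    by (simp add: euclidean_product_topology)
qed

lemma continuous_on_grid_eval [continuous_intros]:
  "continuous_on S (\<lambda>v :: grid_fun. v i j k)"
proof -
  have row: "continuous_on S (\<lambda>v :: grid_fun. v i)"
    by (rule continuous_on_product_then_coordinatewise[OF continuous_on_id])
  have "continuous_on S (\<lambda>v :: grid_fun. v i j)"
    by (rule continuous_on_product_then_coordinatewise[OF row])
  then show ?thesis
    by (rule continuous_on_product_then_coordinatewise)
qed

section \<open>The energy of a time step\<close>

text \<open>
  The grid functions obtained from the old state \<open>\<phi>0\<close> by a step of size \<open>\<tau>\<close> driven by some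
  potential \<open>\<psi>\<close>. A solution of the scheme is such a state whose chemical potential can serve
  as \<open>\<psi>\<close>.
\<close>
definition flow_state :: "real \<Rightarrow> real \<Rightarrow> grid_fun \<Rightarrow> grid_fun \<Rightarrow> grid_fun" where
  "flow_state h \<tau> \<phi>0 \<psi> = (\<lambda>i j k. \<phi>0 i j k + \<tau> * discrete_laplacian h \<psi> i j k)"

text \<open>
  Here \<open>g\<close> stands for the explicit part \<open>8/3 \<phi>0\<^sup>-\<^sup>3\<close> of the chemical potential; any
  nonnegative periodic function may take its place. The derivative of \<open>x\<^sup>-\<^sup>8 / 3\<close> is
  the implicit part \<open>- 8/3 x\<^sup>-\<^sup>9\<close>.
\<close>
definition energy ::
  "nat \<Rightarrow> real \<Rightarrow> real \<Rightarrow> real \<Rightarrow> grid_fun \<Rightarrow> grid_fun \<Rightarrow> grid_fun \<Rightarrow> real" where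
  "energy N h \<tau> \<epsilon> \<phi>0 g \<psi> =
     \<tau> / 2 * dirichlet N h \<psi> \<psi>
     + grid_sum N (\<lambda>i j k. inverse (flow_state h \<tau> \<phi>0 \<psi> i j k) ^ 8 / 3
                          + g i j k * flow_state h \<tau> \<phi>0 \<psi> i j k)
     + \<epsilon>\<^sup>2 / 2 * dirichlet N h (flow_state h \<tau> \<phi>0 \<psi>) (flow_state h \<tau> \<phi>0 \<psi>)"

definition potential :: "real \<Rightarrow> real \<Rightarrow> grid_fun \<Rightarrow> grid_fun \<Rightarrow> grid_fun" where
  "potential h \<epsilon> g \<phi> =
     (\<lambda>i j k. - (8 / 3) * inverse (\<phi> i j k) ^ 9 + g i j k - \<epsilon>\<^sup>2 * discrete_laplacian h \<phi> i j k)"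

lemma C_per_flow_state:
  assumes "\<phi>0 \<in> C_per N" "\<psi> \<in> C_per N"
  shows "flow_state h \<tau> \<phi>0 \<psi> \<in> C_per N"
  unfolding flow_state_def
  by (rule C_per_map2[OF assms(1) C_per_laplacian[OF assms(2)], where f = "\<lambda>x y. x + \<tau> * y"])

lemma C_per_potential:
  assumes "g \<in> C_per N" "\<phi> \<in> C_per N"
  shows "potential h \<epsilon> g \<phi> \<in> C_per N"
  unfolding potential_def using assms(1) C_per_laplacian[OF assms(2)] assms(2)
  by (intro C_perI) (simp_all add: C_perD)

lemma flow_state_minus_const:
  "flow_state h \<tau> \<phi>0 (\<lambda>i j k. \<psi> i j k - c) = flow_state h \<tau> \<phi>0 \<psi>"
  by (simp add: flow_state_def laplacian_minus_const)

lemma flow_state_line: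
  "flow_state h \<tau> \<phi>0 (\<lambda>i j k. \<psi> i j k + t * \<eta> i j k)
    = (\<lambda>i j k. flow_state h \<tau> \<phi>0 \<psi> i j k + t * (\<tau> * discrete_laplacian h \<eta> i j k))"
  by (simp add: flow_state_def laplacian_lincomb algebra_simps fun_eq_iff)

lemma continuous_on_flow_state [continuous_intros]:
  "continuous_on S (\<lambda>\<psi>. flow_state h \<tau> \<phi>0 \<psi> i j k)"
  unfolding flow_state_def discrete_laplacian_def by (intro continuous_intros)

lemma continuous_on_energy:
  assumes "\<And>\<psi> i j k. \<psi> \<in> S \<Longrightarrow> flow_state h \<tau> \<phi>0 \<psi> i j k \<noteq> 0"
  shows "continuous_on S (energy N h \<tau> \<epsilon> \<phi>0 g)"
  unfolding energy_def dirichlet_def grid_sum_def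
  using assms by (intro continuous_intros) auto

text \<open>
  All parts of the energy are nonnegative on positive states, so each is at most \<open>M\<close>. At one grid
  point this gives \<open>\<phi>\<^sup>-\<^sup>8 \<le> 3 M\<close>, hence \<open>\<phi>\<^sup>-\<^sup>1 \<le> max 1 (3 M)\<close>, since a number above \<open>1\<close> is at most
  its eighth power.
\<close>
lemma energy_sublevel_bounds:
  assumes "N \<ge> 1" "\<tau> > 0" "\<phi>0 \<in> C_per N" "\<psi> \<in> C_per N" "g \<in> C_per N"
    and "\<And>i j k. g i j k \<ge> 0" "\<And>i j k. flow_state h \<tau> \<phi>0 \<psi> i j k > 0"
    and M: "energy N h \<tau> \<epsilon> \<phi>0 g \<psi> \<le> M"
  shows "1 / max 1 (3 * M) \<le> flow_state h \<tau> \<phi>0 \<psi> i j k"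
    and "dirichlet N h \<psi> \<psi> \<le> 2 * M / \<tau>"
proof -
  let ?\<phi> = "flow_state h \<tau> \<phi>0 \<psi>"
  let ?w = "\<lambda>i j k. inverse (?\<phi> i j k) ^ 8 / 3 + g i j k * ?\<phi> i j k"
  have wper: "?w \<in> C_per N"
    by (rule C_per_map2[OF C_per_flow_state[OF assms(3,4)] assms(5),
          where f = "\<lambda>x y. inverse x ^ 8 / 3 + y * x"])
  have g\<phi>: "0 \<le> g i j k * ?\<phi> i j k" for i j k
    using assms(6,7)[of i j k] by simp
  have w0: "0 \<le> ?w i j k" for i j k
    using g\<phi>[of i j k] by simp
  have parts: "0 \<le> grid_sum N ?w" "0 \<le> \<tau> / 2 * dirichlet N h \<psi> \<psi>"
    "0 \<le> \<epsilon>\<^sup>2 / 2 * dirichlet N h ?\<phi> ?\<phi>"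
    using assms(2) dirichlet_nonneg w0 by (simp_all add: grid_sum_nonneg)
  then have "\<tau> / 2 * dirichlet N h \<psi> \<psi> \<le> M"
    using M unfolding energy_def by linarith
  then show "dirichlet N h \<psi> \<psi> \<le> 2 * M / \<tau>"
    using assms(2) by (simp add: field_simps)
  have "?w i j k \<le> grid_sum N ?w"
    by (rule le_grid_sum[OF assms(1) wper w0])
  also have "\<dots> \<le> M"
    using parts M unfolding energy_def by linarith
  finally have 8: "inverse (?\<phi> i j k) ^ 8 \<le> 3 * M"
    using g\<phi>[of i j k] by simp
  have "inverse (?\<phi> i j k) \<le> max 1 (3 * M)"
  proof (cases "inverse (?\<phi> i j k) \<le> 1")
    case False
    then have "inverse (?\<phi> i j k) \<le> inverse (?\<phi> i j k) ^ 8"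
      by (intro self_le_power) auto
    then show ?thesis using 8 by linarith
  qed linarith
  then show "1 / max 1 (3 * M) \<le> ?\<phi> i j k"
    using assms(7)[of i j k] by (simp add: field_simps)
qed

text \<open>
  The minimum over the compact set \<open>K\<close> is a minimum over all positive states: states whose energy
  exceeds that of \<open>\<psi> = 0\<close> are no competitors, and all others have a representative in \<open>K\<close> modulo
  constants.
\<close>
lemma energy_minimiser_exists:
  assumes "N \<ge> 1" "\<tau> > 0" "h \<noteq> 0" "\<phi>0 \<in> C_per N" "g \<in> C_per N"
    and "\<And>i j k. \<phi>0 i j k > 0" "\<And>i j k. g i j k \<ge> 0"
  obtains \<psi> where "\<psi> \<in> C_per N" "\<And>i j k. flow_state h \<tau> \<phi>0 \<psi> i j k > 0"
    "\<And>\<psi>'. \<psi>' \<in> C_per N \<Longrightarrow> (\<And>i j k. flow_state h \<tau> \<phi>0 \<psi>' i j k > 0)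
        \<Longrightarrow> energy N h \<tau> \<epsilon> \<phi>0 g \<psi> \<le> energy N h \<tau> \<epsilon> \<phi>0 g \<psi>'"
proof -
  let ?E = "energy N h \<tau> \<epsilon> \<phi>0 g" and ?\<phi> = "flow_state h \<tau> \<phi>0"
  define M where "M = ?E (\<lambda>_ _ _. 0)"
  define \<delta> where "\<delta> = 1 / max 1 (3 * M)"
  define B where "B = 3 * real N * sqrt (h\<^sup>2 * (2 * M / \<tau>))"
  define K where "K = {\<psi>. \<forall>i j k. \<psi> i j k \<in> {-B..B}} \<inter>
    {\<psi>. \<psi> \<in> C_per N \<and> (\<forall>i j k. \<delta> \<le> ?\<phi> \<psi> i j k)}"
  have \<delta>: "\<delta> > 0"
    by (simp add: \<delta>_def)
  have zero: "(\<lambda>_ _ _. 0) \<in> C_per N" "?\<phi> (\<lambda>_ _ _. 0) = \<phi>0"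
    by (simp_all add: C_per_def flow_state_def discrete_laplacian_def)
  have sublevel: "\<exists>\<psi>'\<in>K. ?E \<psi>' = ?E \<psi>"
    if \<psi>: "\<psi> \<in> C_per N" "\<And>i j k. ?\<phi> \<psi> i j k > 0" "?E \<psi> \<le> M" for \<psi>
  proof
    let ?\<psi>' = "\<lambda>i j k. \<psi> i j k - \<psi> 1 1 1"
    show "?E ?\<psi>' = ?E \<psi>"
      by (simp add: energy_def flow_state_minus_const dirichlet_minus_const)
    note bounds = energy_sublevel_bounds[OF assms(1,2,4) \<psi>(1) assms(5,7) \<psi>(2,3)]
    have "sqrt (h\<^sup>2 * dirichlet N h \<psi> \<psi>) \<le> sqrt (h\<^sup>2 * (2 * M / \<tau>))"
      using bounds(2) by (intro real_sqrt_le_mono mult_left_mono) auto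
    then have "\<bar>?\<psi>' i j k\<bar> \<le> B" for i j k
      unfolding B_def
      by (intro order_trans[OF dirichlet_controls_oscillation[OF assms(1,3) \<psi>(1)]] mult_left_mono) auto
    then have "\<forall>i j k. ?\<psi>' i j k \<in> {-B..B}"
      by (metis abs_le_iff atLeastAtMost_iff minus_le_iff)
    moreover have "?\<psi>' \<in> C_per N"
      using C_per_map2[OF \<psi>(1) \<psi>(1), of "\<lambda>x _. x - \<psi> 1 1 1"] by simp
    ultimately show "?\<psi>' \<in> K"
      unfolding K_def using bounds(1) by (simp add: flow_state_minus_const \<delta>_def)
  qed
  have "compact K"
    unfolding K_def
  proof (rule compact_Int_closed)
    show "compact {\<psi> :: grid_fun. \<forall>i j k. \<psi> i j k \<in> {-B..B}}"
      using compact_functions_into[OF compact_functions_into[OF compact_functions_into[OF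
            compact_Icc[of "-B" B]]], where 'a = int] by simp
    show "closed {\<psi>. \<psi> \<in> C_per N \<and> (\<forall>i j k. \<delta> \<le> ?\<phi> \<psi> i j k)}"
      unfolding C_per_def mem_Collect_eq
      by (intro closed_Collect_conj closed_Collect_all closed_Collect_eq closed_Collect_le
          continuous_intros)
  qed
  moreover have "K \<noteq> {}"
    using sublevel[OF zero(1)] zero(2) assms(6) by (auto simp: M_def)
  moreover have pos: "?\<phi> \<psi> i j k > 0" if "\<psi> \<in> K" for \<psi> i j k
    using that \<delta> by (auto simp: K_def intro: less_le_trans)
  then have "continuous_on K ?E"
    by (intro continuous_on_energy) (metis less_irrefl)
  ultimately obtain \<psi> where \<psi>: "\<psi> \<in> K" "\<And>\<psi>'. \<psi>' \<in> K \<Longrightarrow> ?E \<psi> \<le> ?E \<psi>'"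
    using continuous_attains_inf by metis
  show ?thesis
  proof (rule that)
    show "\<psi> \<in> C_per N"
      using \<psi>(1) by (simp add: K_def)
    show "?\<phi> \<psi> i j k > 0" for i j k
      by (rule pos[OF \<psi>(1)])
    have min: "?E \<psi> \<le> ?E \<psi>'"
      if "\<psi>' \<in> C_per N" "\<And>i j k. ?\<phi> \<psi>' i j k > 0" "?E \<psi>' \<le> M" for \<psi>'
      using sublevel[OF that] \<psi>(2) by metis
    have "?E \<psi> \<le> M"
      using min[OF zero(1)] zero(2) assms(6) by (simp add: M_def)
    then show "?E \<psi> \<le> ?E \<psi>'"
      if "\<psi>' \<in> C_per N" "\<And>i j k. ?\<phi> \<psi>' i j k > 0" for \<psi>'
      using min[OF that] by linarith
  qed
qed

text \<open>
  The first variation. The state moves with velocity \<open>\<zeta> = \<tau> \<Delta>\<eta>\<close>, which gives the terms on \<open>\<phi>\<close> the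
  derivative \<open>\<mu> \<zeta>\<close> summed over the grid, while the Dirichlet form of \<open>\<psi>\<close> contributes
  \<open>- \<tau> \<psi> \<Delta>\<eta>\<close> by summation by parts. Both carry the factor \<open>\<tau> \<Delta>\<eta>\<close>, and self-adjointness moves
  the Laplacian from \<open>\<eta>\<close> onto \<open>\<mu> - \<psi>\<close>.
\<close>
lemma DERIV_energy_line:
  assumes "\<phi>0 \<in> C_per N" "\<psi> \<in> C_per N" "\<eta> \<in> C_per N" "g \<in> C_per N"
    and pos: "\<And>i j k. flow_state h \<tau> \<phi>0 \<psi> i j k > 0"
  shows "((\<lambda>t. energy N h \<tau> \<epsilon> \<phi>0 g (\<lambda>i j k. \<psi> i j k + t * \<eta> i j k)) has_real_derivative
           \<tau> * grid_sum N (\<lambda>i j k. \<eta> i j k * discrete_laplacian h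
             (\<lambda>i j k. potential h \<epsilon> g (flow_state h \<tau> \<phi>0 \<psi>) i j k - \<psi> i j k) i j k)) (at 0)"
proof -
  let ?\<phi> = "flow_state h \<tau> \<phi>0 \<psi>" and ?\<mu> = "potential h \<epsilon> g (flow_state h \<tau> \<phi>0 \<psi>)"
  let ?L = "discrete_laplacian h"
  let ?\<zeta> = "\<lambda>i j k. \<tau> * ?L \<eta> i j k"
  note \<phi>per = C_per_flow_state[OF assms(1,2)]
  have \<zeta>per: "?\<zeta> \<in> C_per N"
    using C_per_map2[OF C_per_laplacian[OF assms(3)] assms(3), of "\<lambda>x _. \<tau> * x"] by simp
  have dper: "(\<lambda>i j k. ?\<mu> i j k - \<psi> i j k) \<in> C_per N"
    by (rule C_per_map2[OF C_per_potential[OF assms(4) \<phi>per] assms(2)])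
  have local_part: "((\<lambda>t. inverse (?\<phi> i j k + t * ?\<zeta> i j k) ^ 8 / 3 + g i j k * (?\<phi> i j k + t * ?\<zeta> i j k))
      has_real_derivative (- (8 / 3) * inverse (?\<phi> i j k) ^ 9 + g i j k) * ?\<zeta> i j k) (at 0)" for i j k
    using pos[of i j k]
    by (auto intro!: derivative_eq_intros simp: field_simps power2_eq_square eval_nat_numeral)
  let ?D = "\<tau> / 2 * (2 * dirichlet N h \<psi> \<eta>)
        + grid_sum N (\<lambda>i j k. (- (8 / 3) * inverse (?\<phi> i j k) ^ 9 + g i j k) * ?\<zeta> i j k)
        + \<epsilon>\<^sup>2 / 2 * (2 * dirichlet N h ?\<phi> ?\<zeta>)"
  have deriv: "((\<lambda>t. energy N h \<tau> \<epsilon> \<phi>0 g (\<lambda>i j k. \<psi> i j k + t * \<eta> i j k)) has_real_derivative ?D) (at 0)"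
    unfolding energy_def flow_state_line
    by (intro DERIV_add DERIV_cmult DERIV_dirichlet_line DERIV_grid_sum local_part)
  have d1: "\<tau> / 2 * (2 * dirichlet N h \<psi> \<eta>) = grid_sum N (\<lambda>i j k. - \<tau> * (\<psi> i j k * ?L \<eta> i j k))"
    unfolding grid_sum_cmult sum_by_parts[OF assms(2,3)] by simp
  have d2: "\<epsilon>\<^sup>2 / 2 * (2 * dirichlet N h ?\<phi> ?\<zeta>)
      = grid_sum N (\<lambda>i j k. - \<epsilon>\<^sup>2 * (?\<zeta> i j k * ?L ?\<phi> i j k))"
    unfolding grid_sum_cmult sum_by_parts[OF \<zeta>per \<phi>per] using dirichlet_commute by simp
  have "?D = grid_sum N (\<lambda>i j k. \<tau> * ((?\<mu> i j k - \<psi> i j k) * ?L \<eta> i j k))"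
    unfolding d1 d2 grid_sum_add[symmetric] potential_def
    by (rule arg_cong[where f = "grid_sum N"]) (simp add: fun_eq_iff algebra_simps)
  also have "\<dots> = \<tau> * grid_sum N (\<lambda>i j k. \<eta> i j k * ?L (\<lambda>i j k. ?\<mu> i j k - \<psi> i j k) i j k)"
    unfolding grid_sum_cmult laplacian_self_adjoint[OF dper assms(3)] by (simp add: mult.commute)
  finally show ?thesis
    using deriv by simp
qed

section \<open>Existence and uniqueness\<close>

text \<open>
  Positive states form an open set along every line: the ratio \<open>|\<zeta>| / \<phi>\<close> is periodic, hence
  bounded, so all grid points admit a common step size.
\<close>
lemma positive_near:
  assumes "\<phi> \<in> C_per N" "\<zeta> \<in> C_per N" "N \<ge> 1" "\<And>i j k. \<phi> i j k > 0"
  obtains d where "d > 0" "\<And>t i j k. \<bar>t\<bar> < d \<Longrightarrow> \<phi> i j k + t * \<zeta> i j k > 0"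
proof -
  let ?w = "\<lambda>i j k. \<bar>\<zeta> i j k\<bar> / \<phi> i j k"
  define C where "C = grid_sum N ?w"
  have wper: "?w \<in> C_per N"
    by (rule C_per_map2[OF assms(1,2), where f = "\<lambda>x y. \<bar>y\<bar> / x"])
  have w0: "0 \<le> ?w i j k" for i j k
    using assms(4)[of i j k] by simp
  have w: "?w i j k \<le> C" for i j k
    unfolding C_def by (rule le_grid_sum[OF assms(3) wper w0])
  have C: "0 \<le> C"
    using w w0 order_trans by blast
  show ?thesis
  proof (rule that)
    show "1 / (C + 1) > 0"
      using C by simp
    fix t :: real and i j k
    assume t: "\<bar>t\<bar> < 1 / (C + 1)"
    have "\<bar>\<zeta> i j k\<bar> \<le> C * \<phi> i j k"
      using w[of i j k] assms(4)[of i j k] by (simp add: field_simps)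
    then have "\<bar>t * \<zeta> i j k\<bar> \<le> 1 / (C + 1) * (C * \<phi> i j k)"
      unfolding abs_mult using t C by (intro mult_mono) auto
    also have "\<dots> < \<phi> i j k"
      using C assms(4)[of i j k] by (simp add: field_simps)
    finally show "\<phi> i j k + t * \<zeta> i j k > 0"
      by linarith
  qed
qed

text \<open>
  The minimiser \<open>\<psi>\<close> need not equal the chemical potential \<open>\<mu>\<close>, as it is determined only up to a
  constant; but stationarity in the single direction \<open>\<eta> = \<Delta>(\<mu> - \<psi>)\<close> makes the sum of \<open>\<eta>\<^sup>2\<close>
  vanish, and only \<open>\<Delta>\<psi>\<close> enters the state.
\<close>
lemma scheme_solution_exists:
  assumes "N \<ge> 1" "\<tau> > 0" "h \<noteq> 0" "\<phi>0 \<in> C_per N" "g \<in> C_per N"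
    and "\<And>i j k. \<phi>0 i j k > 0" "\<And>i j k. g i j k \<ge> 0"
  obtains \<phi> where "\<phi> \<in> C_per N" "\<And>i j k. \<phi> i j k > 0"
    "\<And>i j k. (\<phi> i j k - \<phi>0 i j k) / \<tau> = discrete_laplacian h (potential h \<epsilon> g \<phi>) i j k"
proof -
  let ?E = "energy N h \<tau> \<epsilon> \<phi>0 g"
  obtain \<psi> where \<psi>: "\<psi> \<in> C_per N" and pos: "\<And>i j k. flow_state h \<tau> \<phi>0 \<psi> i j k > 0"
    and min: "\<And>\<psi>'. \<psi>' \<in> C_per N \<Longrightarrow> (\<And>i j k. flow_state h \<tau> \<phi>0 \<psi>' i j k > 0)
        \<Longrightarrow> ?E \<psi> \<le> ?E \<psi>'"
    using energy_minimiser_exists[of N \<tau> h \<phi>0 g \<epsilon>] assms by metis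
  define \<phi> where "\<phi> = flow_state h \<tau> \<phi>0 \<psi>"
  define \<mu> where "\<mu> = potential h \<epsilon> g \<phi>"
  define \<eta> where "\<eta> = discrete_laplacian h (\<lambda>i j k. \<mu> i j k - \<psi> i j k)"
  have \<phi>: "\<phi> \<in> C_per N"
    unfolding \<phi>_def by (rule C_per_flow_state[OF assms(4) \<psi>])
  have \<mu>: "\<mu> \<in> C_per N"
    unfolding \<mu>_def by (rule C_per_potential[OF assms(5) \<phi>])
  have \<eta>: "\<eta> \<in> C_per N"
    unfolding \<eta>_def by (rule C_per_laplacian[OF C_per_map2[OF \<mu> \<psi>]])
  have \<zeta>: "(\<lambda>i j k. \<tau> * discrete_laplacian h \<eta> i j k) \<in> C_per N"
    using C_per_map2[OF C_per_laplacian[OF \<eta>] \<eta>, of "\<lambda>x _. \<tau> * x"] by simp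
  obtain d where d: "d > 0"
    "\<And>t i j k. \<bar>t\<bar> < d \<Longrightarrow> \<phi> i j k + t * (\<tau> * discrete_laplacian h \<eta> i j k) > 0"
    using positive_near[OF \<phi> \<zeta> assms(1)] pos unfolding \<phi>_def by metis
  have "?E (\<lambda>i j k. \<psi> i j k + 0 * \<eta> i j k) \<le> ?E (\<lambda>i j k. \<psi> i j k + t * \<eta> i j k)" if "\<bar>t\<bar> < d" for t
  proof -
    have "(\<lambda>i j k. \<psi> i j k + t * \<eta> i j k) \<in> C_per N"
      by (rule C_per_map2[OF \<psi> \<eta>])
    then show ?thesis
      using min d(2)[OF that] by (simp add: flow_state_line \<phi>_def)
  qed
  then have "\<tau> * grid_sum N (\<lambda>i j k. \<eta> i j k * \<eta> i j k) = 0"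
    using DERIV_local_min[OF DERIV_energy_line[OF assms(4) \<psi> \<eta> assms(5) pos] d(1)]
    by (simp add: \<eta>_def \<mu>_def \<phi>_def)
  then have sum0: "grid_sum N (\<lambda>i j k. \<eta> i j k * \<eta> i j k) = 0"
    using assms(2) by simp
  have "\<eta> i j k * \<eta> i j k \<le> 0" for i j k
    using le_grid_sum[OF assms(1) C_per_map2[OF \<eta> \<eta>, of "(*)"]] sum0 by simp
  then have \<eta>0: "\<eta> i j k = 0" for i j k
    by (metis mult_eq_0_iff order_antisym zero_le_square)
  have "(\<phi> i j k - \<phi>0 i j k) / \<tau> = discrete_laplacian h \<mu> i j k" for i j k
    using \<eta>0[of i j k] assms(2) by (simp add: \<eta>_def laplacian_diff \<phi>_def flow_state_def)
  then show ?thesis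
    using that \<phi> pos unfolding \<phi>_def[symmetric] \<mu>_def by blast
qed

lemma inverse_power_antimono_prod:
  fixes x y :: real
  assumes "x > 0" "y > 0"
  shows "(inverse x ^ 9 - inverse y ^ 9) * (x - y) \<le> 0"
    and "(inverse x ^ 9 - inverse y ^ 9) * (x - y) = 0 \<Longrightarrow> x = y"
proof -
  have less: "inverse b ^ 9 < inverse a ^ 9" if "0 < a" "a < b" for a b :: real
    using that by (intro power_strict_mono) auto
  show "(inverse x ^ 9 - inverse y ^ 9) * (x - y) \<le> 0"
    using less[of x y] less[of y x] assms
    by (cases x y rule: linorder_cases) (auto simp: mult_le_0_iff)
  show "x = y" if "(inverse x ^ 9 - inverse y ^ 9) * (x - y) = 0"
    using less[of x y] less[of y x] assms that
    by (cases x y rule: linorder_cases) auto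
qed

text \<open>
  The sum of \<open>m d\<close> is computed in two ways, giving a vanishing sum of three nonnegative terms.
  Its first term is the sum of \<open>s\<close>, the contribution of the singular part, which is positive
  wherever the two solutions differ.
\<close>
lemma scheme_solution_unique:
  assumes "N \<ge> 1" "\<tau> > 0" "g \<in> C_per N"
    and \<phi>: "\<phi> \<in> C_per N" "\<And>i j k. \<phi> i j k > 0"
    "\<And>i j k. (\<phi> i j k - \<phi>0 i j k) / \<tau> = discrete_laplacian h (potential h \<epsilon> g \<phi>) i j k"
    and \<phi>': "\<phi>' \<in> C_per N" "\<And>i j k. \<phi>' i j k > 0"
    "\<And>i j k. (\<phi>' i j k - \<phi>0 i j k) / \<tau> = discrete_laplacian h (potential h \<epsilon> g \<phi>') i j k"
  shows "\<phi> = \<phi>'"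
proof -
  define d where "d = (\<lambda>i j k. \<phi> i j k - \<phi>' i j k)"
  define m where "m = (\<lambda>i j k. potential h \<epsilon> g \<phi> i j k - potential h \<epsilon> g \<phi>' i j k)"
  define s where "s = (\<lambda>i j k. 8 / 3 * (- ((inverse (\<phi> i j k) ^ 9 - inverse (\<phi>' i j k) ^ 9) * d i j k)))"
  have d: "d \<in> C_per N"
    unfolding d_def by (rule C_per_map2[OF \<phi>(1) \<phi>'(1)])
  have m: "m \<in> C_per N"
    unfolding m_def
    by (rule C_per_map2[OF C_per_potential[OF assms(3) \<phi>(1)] C_per_potential[OF assms(3) \<phi>'(1)]])
  have s: "s \<in> C_per N"
    unfolding s_def d_def
    by (rule C_per_map2[OF \<phi>(1) \<phi>'(1), where f = "\<lambda>x y. 8 / 3 * (- ((inverse x ^ 9 - inverse y ^ 9) * (x - y)))"])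
  have s0: "0 \<le> s i j k" for i j k
    unfolding s_def d_def
    using inverse_power_antimono_prod(1)[OF \<phi>(2) \<phi>'(2), of i j k i j k] by linarith
  have dm: "d i j k = \<tau> * discrete_laplacian h m i j k" for i j k
    unfolding m_def laplacian_diff \<phi>(3)[symmetric] \<phi>'(3)[symmetric] d_def
    using assms(2) by (simp add: field_simps)
  have "grid_sum N (\<lambda>i j k. m i j k * d i j k)
      = grid_sum N (\<lambda>i j k. \<tau> * (m i j k * discrete_laplacian h m i j k))"
    unfolding dm by (simp add: mult.left_commute)
  then have md: "grid_sum N (\<lambda>i j k. m i j k * d i j k) = - \<tau> * dirichlet N h m m"
    unfolding grid_sum_cmult sum_by_parts[OF m m] by simp
  have "m i j k * d i j k = s i j k - \<epsilon>\<^sup>2 * (d i j k * discrete_laplacian h d i j k)" for i j k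
    unfolding m_def s_def potential_def d_def laplacian_diff
    by (simp add: algebra_simps diff_divide_distrib)
  then have "grid_sum N (\<lambda>i j k. m i j k * d i j k) = grid_sum N s + \<epsilon>\<^sup>2 * dirichlet N h d d"
    by (simp only: grid_sum_diff grid_sum_cmult sum_by_parts[OF d d] mult_minus_right diff_minus_eq_add)
  then have "grid_sum N s + \<epsilon>\<^sup>2 * dirichlet N h d d + \<tau> * dirichlet N h m m = 0"
    using md by simp
  moreover have "0 \<le> \<epsilon>\<^sup>2 * dirichlet N h d d" "0 \<le> \<tau> * dirichlet N h m m"
    using assms(2) dirichlet_nonneg by simp_all
  ultimately have "grid_sum N s \<le> 0"
    by linarith
  then have "s i j k = 0" for i j k
    using le_grid_sum[OF assms(1) s s0, of i j k] s0[of i j k] by linarith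
  then have "\<phi> i j k = \<phi>' i j k" for i j k
    using inverse_power_antimono_prod(2)[OF \<phi>(2) \<phi>'(2)] unfolding s_def d_def by simp
  then show ?thesis
    by (simp add: fun_eq_iff)
qed

text \<open>
  Conservation of mass: a periodic Laplacian sums to zero over a period.
\<close>
lemma grid_mean_eq_if_laplacian_increment:
  assumes "\<mu> \<in> C_per N" "\<tau> \<noteq> 0"
    and "\<And>i j k. (\<phi> i j k - \<phi>0 i j k) / \<tau> = discrete_laplacian h \<mu> i j k"
  shows "grid_mean L N \<phi> = grid_mean L N \<phi>0"
proof -
  have "\<phi> = (\<lambda>i j k. \<phi>0 i j k + \<tau> * discrete_laplacian h \<mu> i j k)"
    using assms(2,3)[symmetric] by (simp add: fun_eq_iff)
  then have "grid_sum N \<phi> = grid_sum N \<phi>0"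
    using grid_sum_laplacian[OF assms(1), of h] grid_sum_add[of N \<phi>0] grid_sum_cmult[of N \<tau>]
    by simp
  then show ?thesis
    by (simp add: grid_mean_def grid_sum_def)
qed

theorem theorem3p1:
  fixes L \<Delta>t \<epsilon> \<delta>\<^sub>0 :: real and N :: nat and \<phi>\<^sub>n :: grid_fun
  assumes "L > 0" and "N \<ge> 1" and "\<Delta>t > 0" and "\<epsilon> > 0"
    and "\<phi>\<^sub>n \<in> C_per N"
    and "\<delta>\<^sub>0 > 0" and "\<forall>i j k. \<delta>\<^sub>0 \<le> \<phi>\<^sub>n i j k"
  shows "\<exists>!\<phi>. \<phi> \<in> C_per N
     \<and> (\<exists>\<mu> \<in> C_per N.
          (\<forall>i j k. (\<phi> i j k - \<phi>\<^sub>n i j k) / \<Delta>t = discrete_laplacian (mesh L N) \<mu> i j k)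
        \<and> (\<forall>i j k. \<mu> i j k = - (8 / 3) * \<phi> i j k powi (-9) + 8 / 3 * \<phi>\<^sub>n i j k powi (-3)
                              - \<epsilon>\<^sup>2 * discrete_laplacian (mesh L N) \<phi> i j k))
     \<and> grid_mean L N \<phi> = grid_mean L N \<phi>\<^sub>n
     \<and> (\<forall>i j k. \<phi> i j k > 0)"
proof -
  let ?h = "mesh L N"
  define g where "g = (\<lambda>i j k. 8 / 3 * \<phi>\<^sub>n i j k powi (-3))"
  have h: "?h \<noteq> 0"
    using assms(1,2) by (simp add: mesh_def)
  have pos: "\<phi>\<^sub>n i j k > 0" for i j k
    using assms(6,7) less_le_trans by blast
  have g: "g \<in> C_per N"
    using C_per_map2[OF assms(5,5), of "\<lambda>x _. 8 / 3 * x powi (-3)"] by (simp add: g_def)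
  have g0: "g i j k \<ge> 0" for i j k
    using pos[of i j k] by (simp add: g_def)
  have powi9: "x powi (-9) = inverse x ^ 9" for x :: real
    by (simp add: power_int_minus power_inverse)
  have potential_iff: "(\<forall>i j k. \<mu> i j k = - (8 / 3) * \<phi> i j k powi (-9) + 8 / 3 * \<phi>\<^sub>n i j k powi (-3)
      - \<epsilon>\<^sup>2 * discrete_laplacian ?h \<phi> i j k) \<longleftrightarrow> \<mu> = potential ?h \<epsilon> g \<phi>" for \<mu> \<phi>
    by (simp only: powi9 g_def potential_def fun_eq_iff)
  obtain \<phi> where \<phi>: "\<phi> \<in> C_per N" "\<And>i j k. \<phi> i j k > 0"
    "\<And>i j k. (\<phi> i j k - \<phi>\<^sub>n i j k) / \<Delta>t = discrete_laplacian ?h (potential ?h \<epsilon> g \<phi>) i j k"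
    using scheme_solution_exists[OF assms(2,3) h assms(5) g pos g0] by blast
  note \<mu> = C_per_potential[OF g \<phi>(1)]
  have "grid_mean L N \<phi> = grid_mean L N \<phi>\<^sub>n"
    using assms(3) by (intro grid_mean_eq_if_laplacian_increment[OF \<mu> _ \<phi>(3)]) simp
  then show ?thesis
    unfolding potential_iff
    using \<phi> \<mu> scheme_solution_unique[OF assms(2,3) g _ _ _ \<phi>]
    by (intro ex1I[of _ \<phi>]) blast+
qed

end
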